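(* Let $(t_n)_{n\ge 0}$ be a sequence of real numbers, let $t_{i,j}$ be its difference sequence matrix with rows $i=0,1,\dots,l$, and let $g_0(z)=t_{0,0}+t_{0,1}z+t_{0,2}z^2+\cdots\in\mathbb{R}[[z]]$. Define $g_i(z)=g_{i-1}(z)(1-z)$ for $1\le i\le l$. Then: (1) Multiplication by $(1-z)$ is term-wise equivalent to the difference operation: the coefficient of $z^j$ in $g_i(z)$ equals $t_{i,j}$ for all $0\le i\le l$ and $j\ge 0$, i.e. $g_i(z)=\sum_{k=0}^{\infty}t_{i,k}z^k$ for all $0\le i\le l$. (2) Conversely, starting from $g_l(z)$, repeated multiplication by $(1-z)^{-1}$ is term-wise equivalent to repeated partial summation and recovers the rows of the matrix in reverse order: for $1\le i\le l$, $g_i(z)(1-z)^{-1}=g_{i-1}(z)$, with coefficients $t_{i-1,j}=\sum_{k=0}^{j}t_{i,k}$. (3) Suppose the input sequence is given by a univariate polynomial $p$, $t_n=p(n)$ for all $n\ge0$, and that row $l$ is the first row of the matrix having only finitely many nonzero entries, with entries $t_{l,0},\dots,t_{l,w}$ and $t_{l,k}=0$ for $k>w$. Then $$g_0(z)=\frac{t_{l,0}+t_{l,1}z+\cdots+t_{l,w}z^w}{(1-z)^{l}},$$ i.e. this rational function is the ordinary generating function of the input sequence defined by the polynomial $p$.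
   Context: Difference sequence matrix: given a real sequence $(t_n)_{n\ge0}$, set $t_{0,n}=t_n$ for $n\ge 0$ and $t_{i,j}=0$ for all $j<0$ and all $i$, and for $i\ge1$ define $t_{i,j}=t_{i-1,j}-t_{i-1,j-1}$ (backward differences). Rows are counted from $0$. The difference sequence matrix ends at the first row (row $l$) which is a finite sequence, i.e. has only finitely many nonzero entries; that row, $\langle t_{l,0},\dots,t_{l,w}\rangle$, is called the difference sequence key. *)

theory Defs
  imports "HOL-Computational_Algebra.Computational_Algebra"
begin

text \<open>
  Columns are indexed by integers so that the backward difference needs no special case at
  column 0. The convention that every row vanishes at negative columns is imposed on row 0 only;
  for the other rows it follows (\<open>diff_matrix_neg\<close>).
\<close>

primrec diff_matrix :: "(nat \<Rightarrow> real) \<Rightarrow> nat \<Rightarrow> int \<Rightarrow> real" where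
  "diff_matrix t 0 j = (if j < 0 then 0 else t (nat j))"
| "diff_matrix t (Suc i) j = diff_matrix t i j - diff_matrix t i (j - 1)"

lemma diff_matrix_neg: "j < 0 \<Longrightarrow> diff_matrix t i j = 0"
  by (induction i arbitrary: j) auto

definition finite_row :: "(nat \<Rightarrow> real) \<Rightarrow> nat \<Rightarrow> bool" where
  "finite_row t i \<longleftrightarrow> finite {j. diff_matrix t i j \<noteq> 0}"

definition first_finite_row :: "(nat \<Rightarrow> real) \<Rightarrow> nat \<Rightarrow> bool" where
  "first_finite_row t l \<longleftrightarrow> finite_row t l \<and> (\<forall>i<l. \<not> finite_row t i)"

primrec row_gf :: "(nat \<Rightarrow> real) \<Rightarrow> nat \<Rightarrow> real fps" where
  "row_gf t 0 = Abs_fps (\<lambda>n. diff_matrix t 0 (int n))"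
| "row_gf t (Suc i) = row_gf t i * (1 - fps_X)"

end

theory Submission
  imports Defs
begin

text \<open>
  The coefficient of \<open>z\<^sup>j\<close> in \<open>g(z) (1 - z)\<close> is \<open>g\<^sub>j - g\<^sub>j\<^sub>-\<^sub>1\<close>, which is exactly the backward
  difference that produces the next row; the zero entries at negative columns account for the
  missing neighbour of the constant coefficient. Hence \<open>row_gf t i\<close> is the generating function of
  row \<open>i\<close> (\<open>row_gf_eq_Abs_fps\<close>). Since \<open>1 - z\<close> has constant term 1, it is a unit of the power series
  ring, so every step can be undone (\<open>row_gf_mult_inverse_power\<close>); on coefficients the inverse
  step is partial summation, because differences telescope from the zero entry at column \<open>-1\<close>
  (\<open>diff_matrix_eq_partial_sum\<close>).

  Undoing all \<open>l\<close> steps gives \<open>g\<^sub>0 = g\<^sub>l / (1 - z)\<^sup>l\<close>. When row \<open>l\<close> vanishes beyond column \<open>w\<close>, the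
  series \<open>g\<^sub>l\<close> is a polynomial in \<open>z\<close>, and this is the rational form of \<open>g\<^sub>0\<close>
  (\<open>row_gf_0_rational\<close>).
\<close>

text \<open>
  Both sides satisfy the same recursion in \<open>i\<close>. Only \<open>j = 0\<close> is special: the difference then reaches
  into column \<open>-1\<close>, whereas the product with \<open>z\<close> has constant term 0.
\<close>

lemma row_gf_nth: "fps_nth (row_gf t i) j = diff_matrix t i (int j)"
proof (induction i arbitrary: j)
  case 0
  show ?case by simp
next
  case (Suc i)
  show ?case
  proof (cases j)
    case 0
    then show ?thesis
      by (simp add: Suc.IH right_diff_distrib diff_matrix_neg)
  next
    case (Suc k)
    then show ?thesis
      by (simp add: Suc.IH right_diff_distrib)
  qed
qed

lemma row_gf_eq_Abs_fps: "row_gf t i = Abs_fps (\<lambda>k. diff_matrix t i (int k))"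
  by (simp add: fps_eq_iff row_gf_nth)

lemma one_minus_fps_X_mult_inverse:
  "(1 - fps_X) * inverse (1 - fps_X) = (1 :: 'a :: field fps)"
  by (rule inverse_mult_eq_1') simp

lemma row_gf_Suc_mult_inverse: "row_gf t (Suc i) * inverse (1 - fps_X) = row_gf t i"
  by (simp add: mult.assoc one_minus_fps_X_mult_inverse)

lemma row_gf_mult_inverse_power:
  "m \<le> l \<Longrightarrow> row_gf t l * inverse (1 - fps_X) ^ m = row_gf t (l - m)"
proof (induction m)
  case 0
  show ?case by simp
next
  case (Suc m)
  have "row_gf t l * inverse (1 - fps_X) ^ Suc m =
        row_gf t l * inverse (1 - fps_X) ^ m * inverse (1 - fps_X)"
    by (simp only: power_Suc2 mult.assoc)
  also have "\<dots> = row_gf t (Suc (l - Suc m)) * inverse (1 - fps_X)"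
    using Suc by (simp add: Suc_diff_Suc del: row_gf.simps)
  also have "\<dots> = row_gf t (l - Suc m)"
    by (rule row_gf_Suc_mult_inverse)
  finally show ?case .
qed

text \<open>
  The sum telescopes; its lower end contributes nothing because column \<open>-1\<close> is zero.
\<close>

lemma diff_matrix_eq_partial_sum:
  "diff_matrix t i (int j) = (\<Sum>k=0..j. diff_matrix t (Suc i) (int k))"
  by (induction j) (simp_all add: diff_matrix_neg)

lemma row_gf_0_rational:
  assumes "\<And>k. k > w \<Longrightarrow> diff_matrix t l (int k) = 0"
  shows "row_gf t 0 =
    (\<Sum>k=0..w. fps_const (diff_matrix t l (int k)) * fps_X ^ k) / (1 - fps_X) ^ l"
proof -
  have key: "row_gf t l = (\<Sum>k=0..w. fps_const (diff_matrix t l (int k)) * fps_X ^ k)"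
    using assms
    by (intro fps_ext) (auto simp: row_gf_nth fps_sum_nth if_distrib cong: if_cong)
  have "row_gf t 0 = row_gf t l * inverse (1 - fps_X) ^ l"
    using row_gf_mult_inverse_power[of l l t] by (simp del: row_gf.simps)
  \<comment> \<open>Division is multiplication by the inverse here because \<open>(1 - z)\<^sup>l\<close> has constant term 1.\<close>
  also have "\<dots> = row_gf t l / (1 - fps_X) ^ l"
    by (simp add: fps_divide_unit fps_inverse_power fps_power_zeroth del: row_gf.simps)
  finally show ?thesis
    by (simp only: key)
qed

theorem lemma3:
  fixes t :: "nat \<Rightarrow> real" and l :: nat
  shows
    "(\<forall>i\<le>l. (\<forall>j::nat. fps_nth (row_gf t i) j = diff_matrix t i (int j)) \<and>
            row_gf t i = Abs_fps (\<lambda>k. diff_matrix t i (int k)))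
     \<and>
     ((\<forall>i\<in>{1..l}. row_gf t i * inverse (1 - fps_X) = row_gf t (i - 1) \<and>
        (\<forall>j::nat. fps_nth (row_gf t i * inverse (1 - fps_X)) j = diff_matrix t (i - 1) (int j) \<and>
                  diff_matrix t (i - 1) (int j) = (\<Sum>k=0..j. diff_matrix t i (int k)))) \<and>
      (\<forall>m\<le>l. row_gf t l * inverse (1 - fps_X) ^ m =
              Abs_fps (\<lambda>k. diff_matrix t (l - m) (int k))))
     \<and>
     (\<forall>(p :: real poly) (w :: nat).
        (\<forall>n. t n = poly p (of_nat n)) \<and> first_finite_row t l \<and>
        (\<forall>k>w. diff_matrix t l (int k) = 0) \<longrightarrow>
        row_gf t 0 =
          (\<Sum>k=0..w. fps_const (diff_matrix t l (int k)) * fps_X ^ k) / (1 - fps_X) ^ l \<and>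
        Abs_fps (\<lambda>n. poly p (of_nat n)) =
          (\<Sum>k=0..w. fps_const (diff_matrix t l (int k)) * fps_X ^ k) / (1 - fps_X) ^ l)"
proof (intro conjI allI ballI impI)
  fix i j
  show "fps_nth (row_gf t i) j = diff_matrix t i (int j)"
    by (rule row_gf_nth)
  show "row_gf t i = Abs_fps (\<lambda>k. diff_matrix t i (int k))"
    by (rule row_gf_eq_Abs_fps)
next
  fix i j assume "i \<in> {1..l}"
  then obtain i' where i: "i = Suc i'"
    by (cases i) auto
  show step: "row_gf t i * inverse (1 - fps_X) = row_gf t (i - 1)"
    unfolding i diff_Suc_1 by (rule row_gf_Suc_mult_inverse)
  show "fps_nth (row_gf t i * inverse (1 - fps_X)) j = diff_matrix t (i - 1) (int j)"
    unfolding step by (rule row_gf_nth)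
  show "diff_matrix t (i - 1) (int j) = (\<Sum>k=0..j. diff_matrix t i (int k))"
    unfolding i diff_Suc_1 by (rule diff_matrix_eq_partial_sum)
next
  fix m assume "m \<le> l"
  then show "row_gf t l * inverse (1 - fps_X) ^ m =
      Abs_fps (\<lambda>k. diff_matrix t (l - m) (int k))"
    by (simp only: row_gf_mult_inverse_power flip: row_gf_eq_Abs_fps)
next
  fix p :: "real poly" and w :: nat
  assume *: "(\<forall>n. t n = poly p (of_nat n)) \<and> first_finite_row t l \<and>
    (\<forall>k>w. diff_matrix t l (int k) = 0)"
  show rational: "row_gf t 0 =
      (\<Sum>k=0..w. fps_const (diff_matrix t l (int k)) * fps_X ^ k) / (1 - fps_X) ^ l"
    using * by (intro row_gf_0_rational) blast
  have "row_gf t 0 = Abs_fps (\<lambda>n. poly p (of_nat n))"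
    using * by simp
  with rational show "Abs_fps (\<lambda>n. poly p (of_nat n)) =
      (\<Sum>k=0..w. fps_const (diff_matrix t l (int k)) * fps_X ^ k) / (1 - fps_X) ^ l"
    by (simp only:)
qed

end
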